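(* There is a universal constant $C>0$ such that the following property holds. Let $I=[T_0,T_1]\subset\mathbb{R}$ be an interval with $T_0<T_1$, and let $f,g:I\to\mathbb{R}$ be $1$-Lipschitz functions such that $f(T_0)=g(T_0)$, $f(T_1)=g(T_1)$ and $f(t)<g(t)$ for all $t\in(T_0,T_1)$. Then the set $$\{(t,f(t)) : t\in I\}\cup\{(t,g(t)) : t\in I\}\subset\mathbb{R}^2$$ inscribes a square of sidelength at least $$C\cdot\max_{t\in I}\{g(t)-f(t)\}.$$
   Context: A subset $\Gamma\subset\mathbb{R}^2$ is said to inscribe a square if it contains the four vertices of a (not necessarily axis-parallel) square with positive sidelength. The constant $C$ does not depend on $I$, $f$ or $g$. *)

theory Defs
  imports "HOL-Analysis.Analysis"
begin

text \<open>
  The plane is \<^typ>\<open>real \<times> real\<close>, whose library norm and inner product are the Euclidean ones.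
  The vectors \<open>v\<close> and \<open>w\<close> are two sides of the square issuing from the vertex \<open>p\<close>.
\<close>

definition inscribes_square :: "(real \<times> real) set \<Rightarrow> real \<Rightarrow> bool" where
  "inscribes_square \<Gamma> l \<longleftrightarrow>
     l > 0 \<and>
     (\<exists>p v w. norm v = l \<and> norm w = l \<and> v \<bullet> w = 0 \<and>
              {p, p + v, p + v + w, p + w} \<subseteq> \<Gamma>)"

end

theory Submission
  imports Defs
begin

text \<open>
  Extend \<open>f\<close> and \<open>g\<close> to the line by clamping and let \<open>F' = f\<close>, \<open>G' = g\<close>. For a square with vertices
  \<open>p1, p2\<close> on \<open>f\<close> and \<open>p3, p4\<close> on \<open>g\<close>, let \<open>m\<close> be the abscissa of the centre and \<open>p2 - p1 = (u, b)\<close>.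
  The inscribed squares are exactly the critical points of
  \<open>S(m, u, b) = (G(x3) - G(x4)) - (F(x2) - F(x1)) - (u\<^sup>2 - b\<^sup>2)/2\<close>.
  If the Lipschitz constant is less than 1, then \<open>S\<close> is strictly convex in \<open>b\<close>, so that
  \<open>\<psi>(m, u) = min\<^sub>b S(m, u, b)\<close> is a function whose critical points are those of \<open>S\<close>. It is nonpositive
  on the boundary of a rectangle, but at least \<open>M\<^sup>2/8\<close> at the point \<open>(m0, M/4)\<close>, where
  \<open>M = g(m0) - f(m0)\<close>. Its maximum is therefore an inscribed square, and since the critical value is
  at most \<open>3(u\<^sup>2 + b\<^sup>2)\<close>, this square is large. The Lipschitz constant 1 follows by compactness, because
  the size of the squares is bounded from below.
\<close>

section \<open>Two tools from calculus: an envelope lemma and antiderivatives\<close>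

text \<open>Both sides of \<open>le\<close> freeze the second argument at \<open>\<beta> s\<close>,
  so the mean value theorem in the first argument suffices and \<open>\<beta>\<close> need only be
  continuous. In the application \<open>\<beta> s\<close> minimises \<open>P s\<close> and 0
  maximises the minimum.\<close>

lemma envelope_deriv_zero:
  fixes P D :: "real \<Rightarrow> real \<Rightarrow> real" and \<beta> :: "real \<Rightarrow> real"
  assumes der: "\<And>s b. ((\<lambda>s. P s b) has_real_derivative D s b) (at s)"
    and cont: "continuous_on UNIV (\<lambda>z. D (fst z) (snd z))"
    and \<beta>: "continuous_on UNIV \<beta>"
    and le: "eventually (\<lambda>s. P s (\<beta> s) \<le> P 0 (\<beta> s)) (at 0)"
  shows "D 0 (\<beta> 0) = 0"
proof (rule ccontr)
  assume ne: "D 0 (\<beta> 0) \<noteq> 0"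
  define c where "c = D 0 (\<beta> 0)"
  \<comment> \<open>The factor \<open>c\<close> treats both signs of the derivative at once:
    \<open>E\<close> is positive at the origin, hence nearby.\<close>
  define E where "E z = c * D (fst z) (\<beta> (snd z))" for z :: "real \<times> real"
  have "continuous_on UNIV (\<lambda>z. D (fst (fst z, \<beta> (snd z))) (snd (fst z, \<beta> (snd z))))"
    by (rule continuous_on_compose2[OF cont])
       (auto intro!: continuous_intros continuous_on_compose2[OF \<beta>])
  then have "continuous_on UNIV E"
    unfolding E_def by (auto intro!: continuous_intros)
  then have "open {z. E z > 0}"
    by (intro open_Collect_less continuous_intros)
  moreover have "(0, 0) \<in> {z. E z > 0}"
    using ne by (auto simp: E_def c_def zero_less_mult_iff)
  ultimately obtain d where d: "d > 0" "ball (0, 0) d \<subseteq> {z. E z > 0}"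
    by (meson open_contains_ball)
  have pos: "E (r, s) > 0" if "\<bar>r\<bar> < d / 2" "\<bar>s\<bar> < d / 2" for r s
  proof -
    have "dist (0, 0) (r, s) \<le> \<bar>r\<bar> + \<bar>s\<bar>"
      by (simp add: dist_prod_def real_sqrt_sum_squares_less sqrt_sum_squares_le_sum_abs)
    also have "\<dots> < d"
      using that by simp
    finally show ?thesis
      using d by auto
  qed
  obtain e where e: "e > 0" "\<And>s. s \<noteq> 0 \<Longrightarrow> \<bar>s\<bar> < e \<Longrightarrow> P s (\<beta> s) \<le> P 0 (\<beta> s)"
    using le unfolding eventually_at by (auto simp: dist_real_def)
  \<comment> \<open>Moving in the direction of the sign of \<open>c\<close> makes \<open>P\<close>
    strictly larger, against \<open>le\<close>.\<close>
  define s where "s = sgn c * (min d e / 4)"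
  have c: "c \<noteq> 0"
    using ne by (simp add: c_def)
  have s: "s \<noteq> 0" "\<bar>s\<bar> < e" "\<bar>s\<bar> < d / 2" "c * s > 0"
    using c e d by (auto simp: s_def abs_mult sgn_mult sgn_real_def zero_less_mult_iff min_def)
  obtain r where r: "\<bar>r\<bar> < d / 2" "P s (\<beta> s) - P 0 (\<beta> s) = s * D r (\<beta> s)"
  proof (cases "s > 0")
    case True
    then obtain r where "0 < r" "r < s" "P s (\<beta> s) - P 0 (\<beta> s) = (s - 0) * D r (\<beta> s)"
      using MVT2[of 0 s "\<lambda>s'. P s' (\<beta> s)" "\<lambda>r. D r (\<beta> s)"] der by blast
    then show ?thesis
      using that[of r] s by auto
  next
    case False
    then have "s < 0" using s by simp
    then obtain r where "s < r" "r < 0" "P 0 (\<beta> s) - P s (\<beta> s) = (0 - s) * D r (\<beta> s)"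
      using MVT2[of s 0 "\<lambda>s'. P s' (\<beta> s)" "\<lambda>r. D r (\<beta> s)"] der by blast
    then show ?thesis
      using that[of r] s by (auto simp: algebra_simps)
  qed
  have "s * D r (\<beta> s) \<le> 0"
    using r e s by fastforce
  moreover have "c * D r (\<beta> s) > 0"
    using pos[of r s] r s by (simp add: E_def)
  then have "(c * s) * (c * D r (\<beta> s)) > 0"
    using s by (simp only: mult_pos_pos)
  then have "(c * c) * (s * D r (\<beta> s)) > 0"
    by (simp add: algebra_simps)
  ultimately show False
    using c by (smt (verit) mult_nonneg_nonpos zero_le_square)
qed

lemma real_antiderivative:
  fixes f :: "real \<Rightarrow> real"
  assumes "continuous_on UNIV f"
  obtains F where "\<And>x. (F has_real_derivative f x) (at x)"
proof -
  have "\<exists>F. \<forall>x. (-\<infinity>::ereal) < ereal x \<longrightarrow> ereal x < \<infinity> \<longrightarrow> (F has_vector_derivative f x) (at x)"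
    by (rule einterval_antiderivative)
       (use assms in \<open>auto simp: continuous_on_eq_continuous_at\<close>)
  then show ?thesis
    using that by (auto simp: has_real_derivative_iff_has_vector_derivative)
qed

section \<open>The functional \<open>S\<close> and its partial derivatives\<close>

locale lipschitz_pair =
  fixes f g F G :: "real \<Rightarrow> real" and L T0 T1 :: real
  assumes L: "0 \<le> L" "L < 1"
    and f_lip: "\<And>x y. \<bar>f x - f y\<bar> \<le> L * \<bar>x - y\<bar>"
    and g_lip: "\<And>x y. \<bar>g x - g y\<bar> \<le> L * \<bar>x - y\<bar>"
    and F: "\<And>x. (F has_real_derivative f x) (at x)"
    and G: "\<And>x. (G has_real_derivative g x) (at x)"
    and T: "T0 < T1"
    and fg_out: "\<And>x. x \<le> T0 \<or> T1 \<le> x \<Longrightarrow> f x = g x"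
    and fg_le: "\<And>x. f x \<le> g x"
begin

text \<open>The arguments are, in order, the abscissas x3, x4, x2, x1 of the corners. Working with
  antiderivatives makes \<open>S\<close> differentiable although \<open>f\<close> and
  \<open>g\<close> are only Lipschitz.\<close>

definition S :: "real \<Rightarrow> real \<Rightarrow> real \<Rightarrow> real" where
  "S m u b = G (m + (u - b) / 2) - G (m - (u + b) / 2)
           - F (m + (u + b) / 2) + F (m - (u - b) / 2) - (u\<^sup>2 - b\<^sup>2) / 2"

text \<open>The mean rise of the bottom and the top side. The derivative of \<open>S\<close> in
  \<open>b\<close> is \<open>b - N m u b\<close>, so criticality in \<open>b\<close> is a fixed
  point equation.\<close>

definition N :: "real \<Rightarrow> real \<Rightarrow> real \<Rightarrow> real" where
  "N m u b = (g (m + (u - b) / 2) - g (m - (u + b) / 2)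
            + f (m + (u + b) / 2) - f (m - (u - b) / 2)) / 2"

definition Sm :: "real \<Rightarrow> real \<Rightarrow> real \<Rightarrow> real" where
  "Sm m u b = g (m + (u - b) / 2) - g (m - (u + b) / 2)
            - f (m + (u + b) / 2) + f (m - (u - b) / 2)"

definition Su :: "real \<Rightarrow> real \<Rightarrow> real \<Rightarrow> real" where
  "Su m u b = (g (m + (u - b) / 2) + g (m - (u + b) / 2)
            - f (m + (u + b) / 2) - f (m - (u - b) / 2)) / 2 - u"

lemma f_lip1: "\<bar>f x - f y\<bar> \<le> \<bar>x - y\<bar>"
  using f_lip[of x y] mult_right_mono[of L 1 "\<bar>x - y\<bar>"] L by simp

lemma g_lip1: "\<bar>g x - g y\<bar> \<le> \<bar>x - y\<bar>"
  using g_lip[of x y] mult_right_mono[of L 1 "\<bar>x - y\<bar>"] L by simp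

lemma cont_fg: "continuous_on UNIV f" "continuous_on UNIV g"
proof -
  have "1-lipschitz_on UNIV f" "1-lipschitz_on UNIV g"
    using f_lip1 g_lip1 by (auto intro!: lipschitz_onI simp: dist_real_def)
  then show "continuous_on UNIV f" "continuous_on UNIV g"
    by (auto intro: lipschitz_on_continuous_on)
qed

lemma cont_FG: "continuous_on UNIV F" "continuous_on UNIV G"
  by (rule DERIV_continuous_on, rule has_field_derivative_at_within, rule F)
     (rule DERIV_continuous_on, rule has_field_derivative_at_within, rule G)

lemmas cont_compose [continuous_intros] =
  continuous_on_compose2[OF cont_fg(1) _ subset_UNIV]
  continuous_on_compose2[OF cont_fg(2) _ subset_UNIV]
  continuous_on_compose2[OF cont_FG(1) _ subset_UNIV]
  continuous_on_compose2[OF cont_FG(2) _ subset_UNIV]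

lemma der_FG:
  "(h has_real_derivative h') (at x) \<Longrightarrow> ((\<lambda>x. F (h x)) has_real_derivative f (h x) * h') (at x)"
  "(h has_real_derivative h') (at x) \<Longrightarrow> ((\<lambda>x. G (h x)) has_real_derivative g (h x) * h') (at x)"
  by (rule DERIV_chain2[OF F] DERIV_chain2[OF G], assumption)+

lemma S_deriv_m: "((\<lambda>m. S m u b) has_real_derivative Sm m u b) (at m)"
  unfolding S_def Sm_def
  by (auto intro!: derivative_eq_intros der_FG simp: field_simps)

lemma S_deriv_u: "((\<lambda>u. S m u b) has_real_derivative Su m u b) (at u)"
  unfolding S_def Su_def
  by (auto intro!: derivative_eq_intros der_FG simp: field_simps)

lemma S_deriv_b: "((\<lambda>b. S m u b) has_real_derivative b - N m u b) (at b)"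
  unfolding S_def N_def
  by (auto intro!: derivative_eq_intros der_FG simp: field_simps)

section \<open>Minimising over \<open>b\<close>\<close>

text \<open>Each of the four arguments moves by at most \<open>d\<close>, and half the sum of four
  changes is at most \<open>2 * (L * d)\<close>. For fixed \<open>m\<close> and \<open>u\<close>
  this makes \<open>N\<close> a contraction in \<open>b\<close>.\<close>

lemma N_lip: "\<bar>N m u b - N m' u' b'\<bar> \<le> L * (2 * \<bar>m - m'\<bar> + \<bar>u - u'\<bar> + \<bar>b - b'\<bar>)"
proof -
  define d where "d = \<bar>m - m'\<bar> + (\<bar>u - u'\<bar> + \<bar>b - b'\<bar>) / 2"
  have mono: "L * \<bar>x - y\<bar> \<le> L * d" if "\<bar>x - y\<bar> \<le> d" for x y
    using that L by (simp add: mult_left_mono)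
  have "\<bar>g (m + (u - b) / 2) - g (m' + (u' - b') / 2)\<bar> \<le> L * d"
    by (rule order_trans[OF g_lip mono]) (simp add: d_def abs_if field_simps)
  moreover have "\<bar>g (m - (u + b) / 2) - g (m' - (u' + b') / 2)\<bar> \<le> L * d"
    by (rule order_trans[OF g_lip mono]) (simp add: d_def abs_if field_simps)
  moreover have "\<bar>f (m + (u + b) / 2) - f (m' + (u' + b') / 2)\<bar> \<le> L * d"
    by (rule order_trans[OF f_lip mono]) (simp add: d_def abs_if field_simps)
  moreover have "\<bar>f (m - (u - b) / 2) - f (m' - (u' - b') / 2)\<bar> \<le> L * d"
    by (rule order_trans[OF f_lip mono]) (simp add: d_def abs_if field_simps)
  ultimately have "\<bar>N m u b - N m' u' b'\<bar> \<le> 2 * (L * d)"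
    unfolding N_def abs_le_iff by (auto simp: field_simps)
  also have "\<dots> = L * (2 * \<bar>m - m'\<bar> + \<bar>u - u'\<bar> + \<bar>b - b'\<bar>)"
    by (simp add: d_def algebra_simps)
  finally show ?thesis .
qed

definition \<beta> :: "real \<Rightarrow> real \<Rightarrow> real" where
  "\<beta> m u = (THE b. N m u b = b)"

lemma \<beta>_fix: "N m u (\<beta> m u) = \<beta> m u"
proof -
  have "\<exists>!b. N m u b = b"
    by (rule banach_fix_type[OF L])
       (use N_lip[of m u _ m u] in \<open>simp add: dist_real_def\<close>)
  then show ?thesis
    unfolding \<beta>_def by (rule theI')
qed

text \<open>Comparing the two fixed points through \<open>N_lip\<close> bounds their distance by
  \<open>L\<close> times itself plus the change of parameters; absorbing the first term leaves the
  factor \<open>1 - L\<close>.\<close>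

lemma \<beta>_lip: "(1 - L) * \<bar>\<beta> m u - \<beta> m' u'\<bar> \<le> 2 * \<bar>m - m'\<bar> + \<bar>u - u'\<bar>"
proof -
  have "L * (2 * \<bar>m - m'\<bar> + \<bar>u - u'\<bar>) \<le> 1 * (2 * \<bar>m - m'\<bar> + \<bar>u - u'\<bar>)"
    using L by (intro mult_right_mono) auto
  then show ?thesis
    using N_lip[of m u "\<beta> m u" m' u' "\<beta> m' u'"] \<beta>_fix by (simp add: algebra_simps)
qed

lemma cont_\<beta>: "continuous_on UNIV (\<lambda>z. \<beta> (fst z) (snd z))"
proof -
  have "\<bar>\<beta> (fst x) (snd x) - \<beta> (fst y) (snd y)\<bar> \<le> 3 / (1 - L) * dist x y" for x y
  proof -
    have "(1 - L) * \<bar>\<beta> (fst x) (snd x) - \<beta> (fst y) (snd y)\<bar> \<le> 3 * dist x y"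
      using \<beta>_lip[of "fst x" "snd x" "fst y" "snd y"] dist_fst_le[of x y] dist_snd_le[of x y]
      by (simp add: dist_real_def)
    then show ?thesis
      using L by (simp add: field_simps)
  qed
  then have "(3 / (1 - L))-lipschitz_on UNIV (\<lambda>z. \<beta> (fst z) (snd z))"
    using L by (intro lipschitz_onI) (auto simp: dist_real_def)
  then show ?thesis
    by (rule lipschitz_on_continuous_on)
qed

lemma cont_\<beta>2: "continuous_on A h \<Longrightarrow> continuous_on A k \<Longrightarrow> continuous_on A (\<lambda>z. \<beta> (h z) (k z))"
  for h k :: "'c::topological_space \<Rightarrow> real"
  using continuous_on_compose2[OF cont_\<beta>, of A "\<lambda>z. (h z, k z)"]
  by (auto intro: continuous_on_Pair)

text \<open>Since \<open>N\<close> does not increase the distance to its fixed point,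
  \<open>c - N m u c\<close> has the sign of \<open>c - \<beta> m u\<close> or vanishes. Hence
  \<open>S\<close> falls up to \<open>\<beta> m u\<close> and rises after it.\<close>

lemma S_min: "S m u (\<beta> m u) \<le> S m u b"
proof -
  have sgn: "(c - \<beta> m u) * (c - N m u c) \<ge> 0" for c
  proof -
    have *: "\<bar>N m u c - \<beta> m u\<bar> \<le> \<bar>c - \<beta> m u\<bar>"
      using N_lip[of m u c m u "\<beta> m u"] \<beta>_fix[of m u]
        mult_right_mono[of L 1 "\<bar>c - \<beta> m u\<bar>"] L by simp
    show ?thesis
    proof (cases "c \<ge> \<beta> m u")
      case True
      then show ?thesis using * by (intro mult_nonneg_nonneg) auto
    next
      case False
      then show ?thesis using * by (intro mult_nonpos_nonpos) auto
    qed
  qed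
  consider "b = \<beta> m u" | "\<beta> m u < b" | "b < \<beta> m u" by linarith
  then show ?thesis
  proof cases
    case 2
    then obtain c where c: "\<beta> m u < c" "c < b"
      "S m u b - S m u (\<beta> m u) = (b - \<beta> m u) * (c - N m u c)"
      using MVT2[of "\<beta> m u" b "S m u" "\<lambda>c. c - N m u c"] S_deriv_b by blast
    have "c - N m u c \<ge> 0"
      using sgn[of c] c by (simp add: zero_le_mult_iff)
    then show ?thesis
      using c 2 by (smt (verit) mult_nonneg_nonneg)
  next
    case 3
    then obtain c where c: "b < c" "c < \<beta> m u"
      "S m u (\<beta> m u) - S m u b = (\<beta> m u - b) * (c - N m u c)"
      using MVT2[of b "\<beta> m u" "S m u" "\<lambda>c. c - N m u c"] S_deriv_b by blast
    have "c - N m u c \<le> 0"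
      using sgn[of c] c by (simp add: zero_le_mult_iff)
    then show ?thesis
      using c 3 by (smt (verit) mult_nonneg_nonpos)
  qed simp
qed

section \<open>Bounds on \<open>S\<close> inside and on the boundary of the rectangle\<close>

lemma MVT_F: "a \<le> b \<Longrightarrow> \<exists>x\<in>{a..b}. F b - F a = (b - a) * f x"
  using MVT2[of a b F f, OF _ F] by (cases "a = b") (force+)

lemma MVT_G: "a \<le> b \<Longrightarrow> \<exists>x\<in>{a..b}. G b - G a = (b - a) * g x"
  using MVT2[of a b G g, OF _ G] by (cases "a = b") (force+)

lemma MVT_GF: "a \<le> b \<Longrightarrow> \<exists>x\<in>{a..b}. (G b - F b) - (G a - F a) = (b - a) * (g x - f x)"
  using MVT2[of a b "\<lambda>x. G x - F x" "\<lambda>x. g x - f x", OF _ DERIV_diff[OF G F]]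
  by (cases "a = b") (force+)

text \<open>The bound must be uniform in \<open>b\<close>, because nothing is known about the size
  of the minimiser. The width M/4 maximises the resulting bound d M - 2 d^2.\<close>

lemma S_lower:
  assumes "g m - f m = M" "M > 0"
  shows "M\<^sup>2 / 8 \<le> S m (M / 4) b"
proof -
  define d where "d = M / 4"
  have d: "d > 0" using assms by (simp add: d_def)
  obtain x where x: "x \<in> {m - (d + b) / 2..m + (d - b) / 2}"
    "G (m + (d - b) / 2) - G (m - (d + b) / 2) = d * g x"
    using MVT_G[of "m - (d + b) / 2" "m + (d - b) / 2"] d by (auto simp: field_simps)
  obtain y where y: "y \<in> {m - (d - b) / 2..m + (d + b) / 2}"
    "F (m + (d + b) / 2) - F (m - (d - b) / 2) = d * f y"
    using MVT_F[of "m - (d - b) / 2" "m + (d + b) / 2"] d by (auto simp: field_simps)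
  have "\<bar>g x - g m\<bar> \<le> \<bar>b\<bar> / 2 + d / 2"
    using g_lip1[of x m] x by (auto simp: field_simps abs_if split: if_splits)
  moreover have "\<bar>f y - f m\<bar> \<le> \<bar>b\<bar> / 2 + d / 2"
    using f_lip1[of y m] y by (auto simp: field_simps abs_if split: if_splits)
  ultimately have "g x - f y \<ge> M - \<bar>b\<bar> - d"
    using assms by linarith
  then have "d * (g x - f y) \<ge> d * (M - \<bar>b\<bar> - d)"
    using d by (intro mult_left_mono) auto
  moreover have "S m d b = d * (g x - f y) - (d\<^sup>2 - b\<^sup>2) / 2"
    unfolding S_def using x y by (simp add: algebra_simps)
  \<comment> \<open>The term b^2/2 in \<open>S\<close> absorbs the loss d |b| caused by the tilt, at
    the cost of d^2/2.\<close>
  moreover have "(\<bar>b\<bar> - d)\<^sup>2 \<ge> 0" by simp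
  then have "b\<^sup>2 + d\<^sup>2 \<ge> 2 * (d * \<bar>b\<bar>)"
    by (simp add: power2_diff mult.commute)
  moreover have "d * (M - \<bar>b\<bar> - d) = d * M - d * \<bar>b\<bar> - d\<^sup>2"
    by (simp add: algebra_simps power2_eq_square)
  ultimately have "S m d b \<ge> d * M - 2 * d\<^sup>2"
    by argo
  then show ?thesis
    by (simp add: d_def power2_eq_square)
qed

text \<open>The second assumption says that the left side of the square closes up. Along the bottom
  and the top, each of length \<open>u\<close> in abscissa, the values of \<open>f\<close> and
  \<open>g\<close> change by at most \<open>u\<close>, so mean values differ by at most
  \<open>3 * u\<close>.\<close>

lemma S_upper:
  assumes "u \<ge> 0" "g (m - (u + b) / 2) = f (m - (u - b) / 2) + u"
  shows "S m u b \<le> 3 * (u\<^sup>2 + b\<^sup>2)"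
proof -
  define x4 x1 where "x4 = m - (u + b) / 2" and "x1 = m - (u - b) / 2"
  obtain x where x: "x \<in> {x4..m + (u - b) / 2}"
    "G (m + (u - b) / 2) - G x4 = u * g x"
    using MVT_G[of x4 "m + (u - b) / 2"] assms by (auto simp: x4_def field_simps)
  obtain y where y: "y \<in> {x1..m + (u + b) / 2}"
    "F (m + (u + b) / 2) - F x1 = u * f y"
    using MVT_F[of x1 "m + (u + b) / 2"] assms by (auto simp: x1_def field_simps)
  have "\<bar>g x - g x4\<bar> \<le> u"
    using g_lip1[of x x4] x by (auto simp: x4_def field_simps)
  moreover have "\<bar>f y - f x1\<bar> \<le> u"
    using f_lip1[of y x1] y by (auto simp: x1_def field_simps)
  ultimately have "g x - f y \<le> 3 * u"
    using assms by (simp add: x4_def x1_def)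
  then have "u * (g x - f y) \<le> 3 * u\<^sup>2"
    using mult_left_mono[of "g x - f y" "3 * u" u] assms by (simp add: power2_eq_square)
  moreover have "S m u b = u * (g x - f y) - (u\<^sup>2 - b\<^sup>2) / 2"
    unfolding S_def using x y by (simp add: algebra_simps x4_def x1_def)
  ultimately show ?thesis
    using zero_le_power2[of u] zero_le_power2[of b] by argo
qed

text \<open>Without tilt only the antiderivative of the gap \<open>g - f\<close> remains. As
  \<open>\<psi>\<close> is a minimum over \<open>b\<close>, bounding this case from above bounds
  \<open>\<psi>\<close>.\<close>

lemma S0: "S m u 0 = (G (m + u / 2) - F (m + u / 2)) - (G (m - u / 2) - F (m - u / 2)) - u\<^sup>2 / 2"
  unfolding S_def by simp

lemma gap: "g x - f x \<le> 2 * \<bar>x - T0\<bar>" "g x - f x \<le> 2 * \<bar>x - T1\<bar>"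
  using g_lip1[of x T0] f_lip1[of x T0] fg_out[of T0]
    g_lip1[of x T1] f_lip1[of x T1] fg_out[of T1] by (smt (verit))+

lemma gap_bound: "g x - f x \<le> 2 * (T1 - T0)"
  using gap(1)[of x] fg_out[of x] T by (cases "x \<le> T0 \<or> T1 \<le> x") auto

text \<open>The gap vanishes on the left half of the window and is at most \<open>u\<close> on the
  right half, so its integral is at most u^2/2, exactly what \<open>S\<close> subtracts.\<close>

lemma S_left: "u \<ge> 0 \<Longrightarrow> S T0 u 0 \<le> 0"
proof -
  assume u: "u \<ge> 0"
  obtain x where x: "x \<in> {T0 - u / 2..T0}"
    "(G T0 - F T0) - (G (T0 - u / 2) - F (T0 - u / 2)) = u / 2 * (g x - f x)"
    using MVT_GF[of "T0 - u / 2" T0] u by auto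
  obtain y where y: "y \<in> {T0..T0 + u / 2}"
    "(G (T0 + u / 2) - F (T0 + u / 2)) - (G T0 - F T0) = u / 2 * (g y - f y)"
    using MVT_GF[of T0 "T0 + u / 2"] u by auto
  have "g x - f x = 0" "g y - f y \<le> u"
    using x y gap(1)[of y] fg_out[of x] by auto
  moreover from this have "u / 2 * (g y - f y) \<le> u / 2 * u"
    using u by (intro mult_left_mono) auto
  ultimately show ?thesis
    unfolding S0 using x y by (simp add: power2_eq_square)
qed

lemma S_right: "u \<ge> 0 \<Longrightarrow> S T1 u 0 \<le> 0"
proof -
  assume u: "u \<ge> 0"
  obtain x where x: "x \<in> {T1 - u / 2..T1}"
    "(G T1 - F T1) - (G (T1 - u / 2) - F (T1 - u / 2)) = u / 2 * (g x - f x)"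
    using MVT_GF[of "T1 - u / 2" T1] u by auto
  obtain y where y: "y \<in> {T1..T1 + u / 2}"
    "(G (T1 + u / 2) - F (T1 + u / 2)) - (G T1 - F T1) = u / 2 * (g y - f y)"
    using MVT_GF[of T1 "T1 + u / 2"] u by auto
  have "g y - f y = 0" "g x - f x \<le> u"
    using x y gap(2)[of x] fg_out[of y] by auto
  moreover from this have "u / 2 * (g x - f x) \<le> u / 2 * u"
    using u by (intro mult_left_mono) auto
  ultimately show ?thesis
    unfolding S0 using x y by (simp add: power2_eq_square)
qed

text \<open>The width is chosen so that the global bound on the gap equals u/2.\<close>

lemma S_large: "u = 4 * (T1 - T0) \<Longrightarrow> S m u 0 \<le> 0"
proof -
  assume u: "u = 4 * (T1 - T0)"
  then have "u \<ge> 0" using T by simp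
  then obtain x where x: "x \<in> {m - u / 2..m + u / 2}"
    "(G (m + u / 2) - F (m + u / 2)) - (G (m - u / 2) - F (m - u / 2)) = u * (g x - f x)"
    using MVT_GF[of "m - u / 2" "m + u / 2"] by auto
  have "u * (g x - f x) \<le> u * (u / 2)"
    using gap_bound[of x] u \<open>u \<ge> 0\<close> by (intro mult_left_mono) auto
  then show ?thesis
    unfolding S0 using x by (simp add: power2_eq_square)
qed

section \<open>From the maximum of \<open>\<psi>\<close> to an inscribed square\<close>

text \<open>The constant 24 is 8 from \<open>S_lower\<close> times 3 from
  \<open>S_upper\<close>.\<close>

lemma inscribed:
  assumes M: "g m0 - f m0 = M" "M > 0"
  shows "\<exists>x a b. f (x + a) = f x + b \<and> g (x - b) = f x + a \<and> g (x + a - b) = f x + a + b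
           \<and> a\<^sup>2 + b\<^sup>2 \<ge> M\<^sup>2 / 24"
proof -
  define U where "U = 4 * (T1 - T0)"
  define K where "K = {T0..T1} \<times> {0..U}"
  define \<psi> where "\<psi> z = S (fst z) (snd z) (\<beta> (fst z) (snd z))" for z
  have "continuous_on K \<psi>"
    unfolding \<psi>_def S_def by (intro continuous_intros cont_\<beta>2) auto
  moreover have "compact K"
    unfolding K_def by (intro compact_Times) auto
  moreover have m0: "m0 \<in> {T0..T1}"
    using fg_out[of m0] M by force
  have in_K: "(m0, M / 4) \<in> K"
    using m0 M gap_bound[of m0] by (auto simp: K_def U_def)
  ultimately obtain z where z: "z \<in> K" "\<And>w. w \<in> K \<Longrightarrow> \<psi> w \<le> \<psi> z"
    using continuous_attains_sup[of K \<psi>] by blast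
  obtain m u where mu: "z = (m, u)" by force
  define b where "b = \<beta> m u"
  have low: "M\<^sup>2 / 8 \<le> \<psi> z"
    using S_lower[OF M, of "\<beta> m0 (M / 4)"] z(2)[OF in_K] by (simp add: \<psi>_def)
  then have pos: "\<psi> z > 0"
    using M by (smt (verit) zero_less_power divide_pos_pos)
  \<comment> \<open>Comparison with \<open>b = 0\<close> keeps the maximum off all four edges; on
    the edge \<open>u = 0\<close> the value of \<open>S\<close> at \<open>b = 0\<close> is
    zero.\<close>
  have "\<psi> z \<le> S m u 0"
    by (simp add: \<psi>_def mu S_min)
  then have "S m u 0 > 0" using pos by simp
  then have "m \<noteq> T0" "m \<noteq> T1" "u \<noteq> U" "u \<noteq> 0"
    using S_left[of u] S_right[of u] S_large[of u m] S0[of m 0] z(1)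
    by (auto simp: K_def mu U_def)
  then have int: "T0 < m" "m < T1" "0 < u" "u < U"
    using z(1) by (auto simp: K_def mu)
  have "Sm (m + 0) u (\<beta> (m + 0) u) = 0"
  proof (rule envelope_deriv_zero[where P = "\<lambda>s. S (m + s) u" and D = "\<lambda>s. Sm (m + s) u"
        and \<beta> = "\<lambda>s. \<beta> (m + s) u"])
    show "((\<lambda>s. S (m + s) u b) has_real_derivative Sm (m + s) u b) (at s)" for s b
      using DERIV_chain2[OF S_deriv_m DERIV_add[OF DERIV_const DERIV_ident]] by simp
    show "continuous_on UNIV (\<lambda>z. Sm (m + fst z) u (snd z))"
      unfolding Sm_def by (intro continuous_intros) auto
    show "continuous_on UNIV (\<lambda>s. \<beta> (m + s) u)"
      by (intro continuous_intros cont_\<beta>2)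
    \<comment> \<open>Maximality gives \<psi>(m + s, u) \<le> \<psi>(m, u), and minimality in
      \<open>b\<close> lets \<psi>(m, u) be bounded by \<open>S m u\<close> at the shifted
      minimiser.\<close>
    have "S (m + s) u (\<beta> (m + s) u) \<le> S (m + 0) u (\<beta> (m + s) u)"
      if "\<bar>s\<bar> < min (m - T0) (T1 - m)" for s
      using z(2)[of "(m + s, u)"] that int S_min[of m u "\<beta> (m + s) u"]
      by (auto simp: K_def mu \<psi>_def abs_if split: if_splits)
    then show "\<forall>\<^sub>F s in at 0. S (m + s) u (\<beta> (m + s) u) \<le> S (m + 0) u (\<beta> (m + s) u)"
      unfolding eventually_at using int
      by (intro exI[of _ "min (m - T0) (T1 - m)"]) (auto simp: dist_real_def)
  qed
  moreover have "Su m (u + 0) (\<beta> m (u + 0)) = 0"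
  proof (rule envelope_deriv_zero[where P = "\<lambda>s. S m (u + s)" and D = "\<lambda>s. Su m (u + s)"
        and \<beta> = "\<lambda>s. \<beta> m (u + s)"])
    show "((\<lambda>s. S m (u + s) b) has_real_derivative Su m (u + s) b) (at s)" for s b
      using DERIV_chain2[OF S_deriv_u DERIV_add[OF DERIV_const DERIV_ident]] by simp
    show "continuous_on UNIV (\<lambda>z. Su m (u + fst z) (snd z))"
      unfolding Su_def by (intro continuous_intros) auto
    show "continuous_on UNIV (\<lambda>s. \<beta> m (u + s))"
      by (intro continuous_intros cont_\<beta>2)
    have "S m (u + s) (\<beta> m (u + s)) \<le> S m (u + 0) (\<beta> m (u + s))"
      if "\<bar>s\<bar> < min u (U - u)" for s
      using z(2)[of "(m, u + s)"] that int S_min[of m u "\<beta> m (u + s)"]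
      by (auto simp: K_def mu \<psi>_def abs_if split: if_splits)
    then show "\<forall>\<^sub>F s in at 0. S m (u + s) (\<beta> m (u + s)) \<le> S m (u + 0) (\<beta> m (u + s))"
      unfolding eventually_at using int
      by (intro exI[of _ "min u (U - u)"]) (auto simp: dist_real_def)
  qed
  ultimately have crit: "Sm m u b = 0" "Su m u b = 0" "N m u b = b"
    using \<beta>_fix by (auto simp: b_def)
  \<comment> \<open>\<open>x\<close> is the abscissa of p1. \<open>Sm = 0\<close> says that bottom
    and top rise equally, \<open>N = b\<close> that this rise is \<open>b\<close>, and
    \<open>Su = 0\<close> that the mean height is \<open>u\<close>.\<close>
  define x where "x = m - (u - b) / 2"
  have pts: "m + (u - b) / 2 = x + u - b" "m - (u + b) / 2 = x - b" "m + (u + b) / 2 = x + u"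
    by (auto simp: x_def field_simps)
  have eqs: "f (x + u) = f x + b" "g (x - b) = f x + u" "g (x + u - b) = f x + u + b"
    using crit unfolding Sm_def Su_def N_def pts x_def[symmetric] by argo+
  have "S m u b \<le> 3 * (u\<^sup>2 + b\<^sup>2)"
    using S_upper[of u m b] int eqs pts by (simp add: x_def)
  then have "M\<^sup>2 / 24 \<le> u\<^sup>2 + b\<^sup>2"
    using low by (simp add: \<psi>_def mu b_def)
  then show ?thesis
    using eqs by blast
qed

text \<open>
  All vertices lie over the interval: outside it \<open>f = g\<close>, and a vertex lying on both graphs would share
  a graph with both neighbours, one of which is seen under a slope greater than 1.
\<close>

lemma inscribed_inside:
  assumes M: "g m0 - f m0 = M" "M > 0"
  shows "\<exists>x a b. {x, x + a, x + a - b, x - b} \<subseteq> {T0..T1}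
           \<and> f (x + a) = f x + b \<and> g (x - b) = f x + a \<and> g (x + a - b) = f x + a + b
           \<and> a\<^sup>2 + b\<^sup>2 \<ge> M\<^sup>2 / 24"
proof -
  obtain x a b where *: "f (x + a) = f x + b" "g (x - b) = f x + a" "g (x + a - b) = f x + a + b"
    "a\<^sup>2 + b\<^sup>2 \<ge> M\<^sup>2 / 24"
    using inscribed[OF M] by blast
  have "M\<^sup>2 / 24 > 0" using M by simp
  then have ab: "a \<noteq> 0 \<or> b \<noteq> 0" using * by auto
  have ba: "\<bar>b\<bar> \<le> L * \<bar>a\<bar>"
    using f_lip[of "x + a" x] * by simp
  with ab have a: "a \<noteq> 0" by auto
  have "L * \<bar>a\<bar> < \<bar>a\<bar>"
    using a L by simp
  with ba have ba': "\<bar>b\<bar> < \<bar>a\<bar>" by simp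
  \<comment> \<open>Here \<open>y\<close> and \<open>y'\<close> are the abscissas of two corners
    joined by a side parallel to (-b, a).\<close>
  have ne: "f y \<noteq> g y" if "\<bar>y - y'\<bar> \<le> \<bar>b\<bar>" "\<bar>g y' - f y\<bar> = \<bar>a\<bar> \<or> \<bar>g y - f y'\<bar> = \<bar>a\<bar>" for y y'
    using g_lip1[of y y'] f_lip1[of y y'] that ba' by auto
  have "f x \<noteq> g x" "f (x + a) \<noteq> g (x + a)" "f (x + a - b) \<noteq> g (x + a - b)" "f (x - b) \<noteq> g (x - b)"
    using ne[of x "x - b"] ne[of "x + a" "x + a - b"] ne[of "x + a - b" "x + a"] ne[of "x - b" x] *
    by auto
  then have "{x, x + a, x + a - b, x - b} \<subseteq> {T0..T1}"
    using fg_out by (auto simp: not_le[symmetric]) (meson linear)+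
  then show ?thesis
    using * by blast
qed

end

section \<open>From Lipschitz constants below 1 to the constant 1\<close>

definition clamp_fun :: "real \<Rightarrow> real \<Rightarrow> (real \<Rightarrow> real) \<Rightarrow> real \<Rightarrow> real" where
  "clamp_fun T0 T1 f x = f (max T0 (min T1 x))"

lemma clamp_fun_eq: "x \<in> {T0..T1} \<Longrightarrow> clamp_fun T0 T1 f x = f x"
  by (simp add: clamp_fun_def)

text \<open>The bound \<open>T1 - T0\<close> will control the error that rescaling the functions
  causes in the limit argument.\<close>

lemma clamp_fun_lipschitz:
  assumes "1-lipschitz_on {T0..T1} f" "T0 \<le> T1"
  shows "\<bar>clamp_fun T0 T1 f x - clamp_fun T0 T1 f y\<bar> \<le> min \<bar>x - y\<bar> (T1 - T0)"
proof -
  have "\<bar>clamp_fun T0 T1 f x - clamp_fun T0 T1 f y\<bar> \<le> \<bar>max T0 (min T1 x) - max T0 (min T1 y)\<bar>"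
    using lipschitz_onD[OF assms(1), of "max T0 (min T1 x)" "max T0 (min T1 y)"] assms(2)
    by (simp add: clamp_fun_def dist_real_def)
  then show ?thesis
    using assms(2) by linarith
qed

text \<open>Multiplying both functions by \<open>1 - \<eta>\<close> makes them strict contractions.
  The resulting square is inscribed in the scaled graphs; its equations are stated for
  \<open>f\<close> and \<open>g\<close> to prepare the limit \<eta> \<rightarrow> 0.\<close>

lemma inscribed_scaled:
  fixes f g :: "real \<Rightarrow> real"
  assumes T: "T0 < T1" and \<eta>: "0 < \<eta>" "\<eta> \<le> 1 / 2"
    and f: "\<And>x y. \<bar>f x - f y\<bar> \<le> \<bar>x - y\<bar>" and g: "\<And>x y. \<bar>g x - g y\<bar> \<le> \<bar>x - y\<bar>"
    and out: "\<And>x. x \<le> T0 \<or> T1 \<le> x \<Longrightarrow> f x = g x" and le: "\<And>x. f x \<le> g x"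
    and M: "g m0 - f m0 = M" "M > 0"
  shows "\<exists>x a b. {x, x + a, x + a - b, x - b} \<subseteq> {T0..T1}
           \<and> (1 - \<eta>) * (f (x + a) - f x) = b \<and> (1 - \<eta>) * (g (x - b) - f x) = a
           \<and> (1 - \<eta>) * (g (x + a - b) - f x) = a + b
           \<and> a\<^sup>2 + b\<^sup>2 \<ge> M\<^sup>2 / 100"
proof -
  define fs gs where "fs x = (1 - \<eta>) * f x" and "gs x = (1 - \<eta>) * g x" for x
  have lip: "\<bar>fs x - fs y\<bar> \<le> (1 - \<eta>) * \<bar>x - y\<bar>" "\<bar>gs x - gs y\<bar> \<le> (1 - \<eta>) * \<bar>x - y\<bar>" for x y
    using mult_left_mono[OF f[of x y], of "1 - \<eta>"] mult_left_mono[OF g[of x y], of "1 - \<eta>"] \<eta>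
    by (auto simp: fs_def gs_def abs_mult right_diff_distrib[symmetric])
  have "(1 - \<eta>)-lipschitz_on UNIV fs" "(1 - \<eta>)-lipschitz_on UNIV gs"
    using lip \<eta> by (auto intro!: lipschitz_onI simp: dist_real_def)
  then have "continuous_on UNIV fs" "continuous_on UNIV gs"
    by (auto intro: lipschitz_on_continuous_on)
  then obtain F G where "\<And>x. (F has_real_derivative fs x) (at x)"
    "\<And>x. (G has_real_derivative gs x) (at x)"
    by (metis real_antiderivative)
  then interpret lipschitz_pair fs gs F G "1 - \<eta>" T0 T1
    using lip \<eta> T out le by unfold_locales (auto simp: fs_def gs_def intro: mult_left_mono)
  have *: "gs m0 - fs m0 = (1 - \<eta>) * M" "(1 - \<eta>) * M > 0"
    using M \<eta> by (auto simp: fs_def gs_def algebra_simps)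
  obtain x a b where 1: "{x, x + a, x + a - b, x - b} \<subseteq> {T0..T1}"
    "fs (x + a) = fs x + b" "gs (x - b) = fs x + a" "gs (x + a - b) = fs x + a + b"
    "((1 - \<eta>) * M)\<^sup>2 / 24 \<le> a\<^sup>2 + b\<^sup>2"
    using inscribed_inside[OF *] by blast
  have q: "(1 / 2 * M)\<^sup>2 = M\<^sup>2 / 4"
    by (simp add: power2_eq_square)
  \<comment> \<open>The gap shrinks at most by half, which gives M^2/96; rounding 96 up to 100 makes
    the final constant a rational square root.\<close>
  have "(1 / 2 * M)\<^sup>2 \<le> ((1 - \<eta>) * M)\<^sup>2"
    using \<eta> M by (intro power_mono mult_right_mono) auto
  then have "M\<^sup>2 / 100 \<le> a\<^sup>2 + b\<^sup>2"
    using 1(5) zero_le_power2[of a] zero_le_power2[of b] q by linarith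
  with 1 show ?thesis
    unfolding fs_def gs_def right_diff_distrib
    by (intro exI[of _ x] exI[of _ a] exI[of _ b]) simp
qed

text \<open>Instead of a convergent sequence, the total defect \<open>D\<close> of the three square
  equations is minimised over the compact set \<open>K\<close>. The lower bound on a^2 + b^2 in
  \<open>K\<close> prevents the square from degenerating.\<close>

lemma inscribed_limit:
  fixes f g :: "real \<Rightarrow> real"
  assumes T: "T0 < T1"
    and f: "\<And>x y. \<bar>f x - f y\<bar> \<le> min \<bar>x - y\<bar> (T1 - T0)"
    and g: "\<And>x y. \<bar>g x - g y\<bar> \<le> min \<bar>x - y\<bar> (T1 - T0)"
    and out: "\<And>x. x \<le> T0 \<or> T1 \<le> x \<Longrightarrow> f x = g x" and le: "\<And>x. f x \<le> g x"
    and M: "g m0 - f m0 = M" "M > 0"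
  shows "\<exists>x a b. {x, x + a, x + a - b, x - b} \<subseteq> {T0..T1}
           \<and> f (x + a) = f x + b \<and> g (x - b) = f x + a \<and> g (x + a - b) = f x + a + b
           \<and> a\<^sup>2 + b\<^sup>2 \<ge> M\<^sup>2 / 100"
proof -
  define W where "W = T1 - T0"
  have W: "W > 0" using T by (simp add: W_def)
  have f1: "\<bar>f x - f y\<bar> \<le> \<bar>x - y\<bar>" "\<bar>f x - f y\<bar> \<le> W" for x y
    using f[of x y] by (auto simp: W_def)
  have g1: "\<bar>g x - g y\<bar> \<le> \<bar>x - y\<bar>" "\<bar>g x - g y\<bar> \<le> W" for x y
    using g[of x y] by (auto simp: W_def)
  have "1-lipschitz_on UNIV f" "1-lipschitz_on UNIV g"
    using f1 g1 by (auto intro!: lipschitz_onI simp: dist_real_def)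
  then have "continuous_on UNIV f" "continuous_on UNIV g"
    by (auto intro: lipschitz_on_continuous_on)
  then have cont: "continuous_on A (\<lambda>z. f (h z))" "continuous_on A (\<lambda>z. g (h z))"
    if "continuous_on A h" for A and h :: "real \<times> real \<times> real \<Rightarrow> real"
    using that by (auto intro: continuous_on_compose2)
  define B where "B = {T0..T1} \<times> {-W..W} \<times> {-W..W}"
  define K where "K = B \<inter> {(x, a, b). {x, x + a, x + a - b, x - b} \<subseteq> {T0..T1} \<and> M\<^sup>2 / 100 \<le> a\<^sup>2 + b\<^sup>2}"
  define D where "D = (\<lambda>(x, a, b). \<bar>f (x + a) - f x - b\<bar> + \<bar>g (x - b) - f x - a\<bar>
    + \<bar>g (x + a - b) - f x - (a + b)\<bar>)"
  have "closed {z :: real \<times> real \<times> real. case z of (x, a, b) \<Rightarrow>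
      {x, x + a, x + a - b, x - b} \<subseteq> {T0..T1} \<and> M\<^sup>2 / 100 \<le> a\<^sup>2 + b\<^sup>2}"
    unfolding case_prod_unfold insert_subset atLeastAtMost_iff
    by (intro closed_Collect_conj closed_Collect_le closed_Collect_const continuous_intros) auto
  then have K: "compact K"
    unfolding K_def B_def by (intro compact_Int_closed compact_Times) auto
  have D: "continuous_on K D"
    unfolding D_def case_prod_unfold by (intro continuous_intros cont)
  have approx: "\<exists>z\<in>K. D z \<le> \<eta> * (9 * W)" if \<eta>: "0 < \<eta>" "\<eta> \<le> 1 / 2" for \<eta>
  proof -
    obtain x a b where 1: "{x, x + a, x + a - b, x - b} \<subseteq> {T0..T1}"
      "(1 - \<eta>) * (f (x + a) - f x) = b" "(1 - \<eta>) * (g (x - b) - f x) = a"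
      "(1 - \<eta>) * (g (x + a - b) - f x) = a + b" "M\<^sup>2 / 100 \<le> a\<^sup>2 + b\<^sup>2"
      using inscribed_scaled[OF T \<eta> f1(1) g1(1) out le M] by blast
    have "(x, a, b) \<in> K"
      using 1 by (auto simp: K_def B_def W_def)
    moreover have gf: "\<bar>g y - f z\<bar> \<le> 3 * W" for y z
    proof -
      have "\<bar>g y - g T0\<bar> \<le> W" "\<bar>f z - f T0\<bar> \<le> W" "f T0 = g T0"
        using g1(2) f1(2) out[of T0] by blast+
      then show ?thesis using W by linarith
    qed
    \<comment> \<open>A scaled equation fails for the unscaled functions by
      \<open>\<eta> * p\<close> only; three such errors give the factor 9.\<close>
    have bd: "\<bar>p - q\<bar> \<le> \<eta> * (3 * W)" if "(1 - \<eta>) * p = q" "\<bar>p\<bar> \<le> 3 * W" for p q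
    proof -
      have "p - q = \<eta> * p" using that by (simp add: algebra_simps)
      then show ?thesis
        using that \<eta> by (simp add: abs_mult)
    qed
    have "D (x, a, b) \<le> \<eta> * (9 * W)"
      using bd[OF 1(2)] bd[OF 1(3) gf] bd[OF 1(4) gf] f1(2)[of "x + a" x] W
      unfolding D_def by simp
    ultimately show ?thesis by blast
  qed
  then have "K \<noteq> {}" by (meson empty_iff half_gt_zero_iff order_refl zero_less_one)
  then obtain z where z: "z \<in> K" "\<And>w. w \<in> K \<Longrightarrow> D z \<le> D w"
    using continuous_attains_inf[OF K _ D] by blast
  have "D z \<le> 0"
  proof (rule ccontr)
    assume "\<not> D z \<le> 0"
    \<comment> \<open>This choice would force the minimum of \<open>D\<close> below half of
      itself.\<close>
    define \<eta> where "\<eta> = min (1 / 2) (D z / (18 * W))"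
    have "0 < \<eta>" "\<eta> \<le> 1 / 2"
      using \<open>\<not> D z \<le> 0\<close> W by (auto simp: \<eta>_def)
    then obtain w where "w \<in> K" "D w \<le> \<eta> * (9 * W)"
      using approx by blast
    then have "D z \<le> \<eta> * (9 * W)"
      using z(2) by fastforce
    also have "\<dots> \<le> D z / (18 * W) * (9 * W)"
      using W by (intro mult_right_mono) (auto simp: \<eta>_def)
    also have "\<dots> = D z / 2"
      using W by simp
    finally show False
      using \<open>\<not> D z \<le> 0\<close> by simp
  qed
  moreover obtain x a b where xab: "z = (x, a, b)"
    by (metis prod.exhaust)
  ultimately have "f (x + a) = f x + b \<and> g (x - b) = f x + a \<and> g (x + a - b) = f x + a + b"
    unfolding D_def by auto
  with z(1) show ?thesis
    unfolding K_def xab by blast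
qed

section \<open>The theorem for functions on the interval\<close>

theorem theorem1p1:
  shows "\<exists>C::real. C > 0 \<and>
    (\<forall>(T0::real) (T1::real) (f::real \<Rightarrow> real) (g::real \<Rightarrow> real).
       T0 < T1 \<longrightarrow>
       1-lipschitz_on {T0..T1} f \<longrightarrow>
       1-lipschitz_on {T0..T1} g \<longrightarrow>
       f T0 = g T0 \<longrightarrow>
       f T1 = g T1 \<longrightarrow>
       (\<forall>t\<in>{T0<..<T1}. f t < g t) \<longrightarrow>
       (\<exists>l. l \<ge> C * (SUP t\<in>{T0..T1}. g t - f t) \<and>
            inscribes_square ({(t, f t) | t. t \<in> {T0..T1}} \<union> {(t, g t) | t. t \<in> {T0..T1}}) l))"
proof (rule exI[of _ "1 / 10"], intro conjI allI impI)
  fix T0 T1 :: real and f g :: "real \<Rightarrow> real"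
  assume T: "T0 < T1" and f: "1-lipschitz_on {T0..T1} f" and g: "1-lipschitz_on {T0..T1} g"
    and ends: "f T0 = g T0" "f T1 = g T1" and less: "\<forall>t\<in>{T0<..<T1}. f t < g t"
  have "continuous_on {T0..T1} (\<lambda>t. g t - f t)"
    using f g by (intro continuous_intros lipschitz_on_continuous_on)
  then obtain m0 where m0: "m0 \<in> {T0..T1}" "\<And>t. t \<in> {T0..T1} \<Longrightarrow> g t - f t \<le> g m0 - f m0"
    using continuous_attains_sup[of "{T0..T1}" "\<lambda>t. g t - f t"] T by fastforce
  define M where "M = g m0 - f m0"
  have sup: "(SUP t\<in>{T0..T1}. g t - f t) = M"
    unfolding M_def using m0 by (intro cSup_eq_maximum) auto
  have "g ((T0 + T1) / 2) - f ((T0 + T1) / 2) > 0"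
    using less T by (simp add: field_simps)
  then have M: "M > 0"
    using m0(2)[of "(T0 + T1) / 2"] T by (simp add: M_def)
  let ?f = "clamp_fun T0 T1 f" and ?g = "clamp_fun T0 T1 g"
  have out: "?f x = ?g x" if "x \<le> T0 \<or> T1 \<le> x" for x
    using that ends T by (auto simp: clamp_fun_def max_def min_def)
  moreover have "?f x \<le> ?g x" for x
  proof (cases "x \<le> T0 \<or> T1 \<le> x")
    case False
    then show ?thesis
      using less by (auto simp: clamp_fun_def intro: less_imp_le)
  qed (use out in force)
  moreover have "?g m0 - ?f m0 = M"
    using m0 by (simp add: clamp_fun_eq M_def)
  ultimately obtain x a b where sq: "{x, x + a, x + a - b, x - b} \<subseteq> {T0..T1}"
    "?f (x + a) = ?f x + b" "?g (x - b) = ?f x + a" "?g (x + a - b) = ?f x + a + b"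
    "M\<^sup>2 / 100 \<le> a\<^sup>2 + b\<^sup>2"
    using inscribed_limit[of T0 T1 ?f ?g m0 M] T M
      clamp_fun_lipschitz[OF f] clamp_fun_lipschitz[OF g] by (metis less_imp_le)
  then have eqs: "f (x + a) = f x + b" "g (x - b) = f x + a" "g (x + a - b) = f x + a + b"
    by (simp_all add: clamp_fun_eq)
  define l where "l = sqrt (a\<^sup>2 + b\<^sup>2)"
  have l: "l \<ge> M / 10"
    unfolding l_def by (rule real_le_rsqrt) (use sq(5) in \<open>simp add: power_divide\<close>)
  have "inscribes_square ({(t, f t) | t. t \<in> {T0..T1}} \<union> {(t, g t) | t. t \<in> {T0..T1}}) l"
    unfolding inscribes_square_def
  proof (intro conjI exI)
    show "l > 0" using l M by simp
    \<comment> \<open>The second side is the first one turned by a right angle, leading from the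
      graph of \<open>f\<close> to that of \<open>g\<close>.\<close>
    show "norm (a, b) = l" "norm (-b, a) = l"
      by (simp_all add: l_def norm_Pair add.commute)
    show "(a, b) \<bullet> (-b, a) = 0"
      by (simp add: inner_prod_def)
    have "(x, f x) + (a, b) = (x + a, f (x + a))"
      "(x, f x) + (a, b) + (- b, a) = (x + a - b, g (x + a - b))"
      "(x, f x) + (- b, a) = (x - b, g (x - b))"
      using eqs by simp_all
    then show "{(x, f x), (x, f x) + (a, b), (x, f x) + (a, b) + (- b, a), (x, f x) + (- b, a)}
        \<subseteq> {(t, f t) | t. t \<in> {T0..T1}} \<union> {(t, g t) | t. t \<in> {T0..T1}}"
      using sq(1) by (simp only: insert_subset) blast
  qed
  then show "\<exists>l\<ge>1 / 10 * (SUP t\<in>{T0..T1}. g t - f t).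
      inscribes_square ({(t, f t) | t. t \<in> {T0..T1}} \<union> {(t, g t) | t. t \<in> {T0..T1}}) l"
    using l sup by auto
qed simp

end
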